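(* Let $A$, $B$, $\mathbb{Y}$, $A_1$, $B_1$, $C_1$ and $C_1-B_1$ be positive stable matrices in $\mathbb{C}^{r\times r}$ such that $B_1C_1=C_1B_1$. Then for every integer $n\ge0$ and every $z\in\mathbb{C}$ with $|z|<1$, $$\frac{d^n}{dz^n}\,{}_2F_1^{(A,B;\mathbb{Y})}(A_1,B_1;C_1;z)=(A_1)_n\;{}_2F_1^{(A,B;\mathbb{Y})}(A_1+nI,B_1+nI;C_1+nI;z)\;(B_1)_n\,(C_1)_n^{-1}.$$
   Context: A matrix in $\mathbb{C}^{r\times r}$ is positive stable if all its eigenvalues have positive real part; $I$ is the identity matrix. For $t>0$ and a square matrix $M$, $t^M=\exp(M\ln t)$. The Pochhammer symbol is $(M)_0=I$, $(M)_n=M(M+I)\cdots(M+(n-1)I)$ for $n\ge1$, and $(M)_n^{-1}$ is the inverse of $(M)_n$. For positive stable $B$ and a square matrix $W$, ${}_1F_1(A;B;W)=\sum_{n\ge0}(A)_n\,(B)_n^{-1}\,\frac{W^n}{n!}$. For commuting positive stable $P,Q$, the beta matrix function is $\mathfrak{B}(P,Q)=\Gamma(P)\Gamma(Q)\Gamma^{-1}(P+Q)=\int_0^1t^{P-I}(1-t)^{Q-I}dt$, where $\Gamma(P)=\int_0^\infty e^{-t}t^{P-I}dt$. For positive stable $A,B,P,Q,\mathbb{Y}$, $$\mathfrak{B}_{\mathbb{Y}}^{(A,B)}(P,Q)=\int_0^1 {}_1F_1\!\left(A;B;-\frac{\mathbb{Y}}{t(1-t)}\right)t^{P-I}(1-t)^{Q-I}\,dt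 .$$ The new extended Gauss hypergeometric matrix function is $${}_2F_1^{(A,B;\mathbb{Y})}(A_1,B_1;C_1;z)=\sum_{n=0}^\infty (A_1)_n\,\mathfrak{B}_{\mathbb{Y}}^{(A,B)}(B_1+nI,C_1-B_1)\,[\mathfrak{B}(B_1,C_1-B_1)]^{-1}\,\frac{z^n}{n!}.$$ *)

theory Defs
  imports "HOL-Analysis.Analysis"
begin

text \<open>
  The product \<open>*\<close> of \<open>complex^'r^'r\<close> is entrywise, so \<open>^\<close> and \<open>exp\<close> cannot be used for matrices;
  powers and the exponential are built from \<open>**\<close> instead.
  Series and integrals are taken in the normed space of matrices, that is, entrywise.
\<close>

definition mscale :: "complex \<Rightarrow> complex^'r^'r \<Rightarrow> complex^'r^'r" where
  "mscale c M = (\<chi> i j. c * M $ i $ j)"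

definition positive_stable :: "complex^'r^'r \<Rightarrow> bool" where
  "positive_stable M \<longleftrightarrow> (\<forall>c v. v \<noteq> 0 \<and> M *v v = c *s v \<longrightarrow> Re c > 0)"

primrec mpow :: "complex^'r^'r \<Rightarrow> nat \<Rightarrow> complex^'r^'r" where
  "mpow M 0 = mat 1"
| "mpow M (Suc n) = mpow M n ** M"

definition mexp :: "complex^'r^'r \<Rightarrow> complex^'r^'r" where
  "mexp M = (\<Sum>n. (1 / fact n) *\<^sub>R mpow M n)"

text \<open>The matrix power \<open>t\<^sup>M\<close>, meant for \<open>t > 0\<close>.\<close>
definition mpowr :: "real \<Rightarrow> complex^'r^'r \<Rightarrow> complex^'r^'r" where
  "mpowr t M = mexp (ln t *\<^sub>R M)"

primrec mpoch :: "complex^'r^'r \<Rightarrow> nat \<Rightarrow> complex^'r^'r" where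
  "mpoch M 0 = mat 1"
| "mpoch M (Suc n) = mpoch M n ** (M + mat (of_nat n))"

text \<open>
  The matrices involved need not commute, so the order of the factors matters in all the
  definitions below.
\<close>

definition hyp1F1 :: "complex^'r^'r \<Rightarrow> complex^'r^'r \<Rightarrow> complex^'r^'r \<Rightarrow> complex^'r^'r" where
  "hyp1F1 A B W = (\<Sum>n. (1 / fact n) *\<^sub>R (mpoch A n ** matrix_inv (mpoch B n) ** mpow W n))"

definition mGamma :: "complex^'r^'r \<Rightarrow> complex^'r^'r" where
  "mGamma P = (LINT t:{0<..}|lborel. exp (- t) *\<^sub>R mpowr t (P - mat 1))"

definition mBeta :: "complex^'r^'r \<Rightarrow> complex^'r^'r \<Rightarrow> complex^'r^'r" where
  "mBeta P Q = mGamma P ** mGamma Q ** matrix_inv (mGamma (P + Q))"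

definition ext_mBeta ::
  "complex^'r^'r \<Rightarrow> complex^'r^'r \<Rightarrow> complex^'r^'r \<Rightarrow> complex^'r^'r \<Rightarrow> complex^'r^'r \<Rightarrow> complex^'r^'r"
  where
  "ext_mBeta A B Y P Q =
     (LINT t:{0<..<1}|lborel.
        hyp1F1 A B (- ((1 / (t * (1 - t))) *\<^sub>R Y))
          ** mpowr t (P - mat 1) ** mpowr (1 - t) (Q - mat 1))"

definition ext_hyp2F1 ::
  "complex^'r^'r \<Rightarrow> complex^'r^'r \<Rightarrow> complex^'r^'r \<Rightarrow>
   complex^'r^'r \<Rightarrow> complex^'r^'r \<Rightarrow> complex^'r^'r \<Rightarrow> complex \<Rightarrow> complex^'r^'r"
  where
  "ext_hyp2F1 A B Y A1 B1 C1 z =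
     (\<Sum>n. mscale (z ^ n / fact n)
        (mpoch A1 n ** ext_mBeta A B Y (B1 + mat (of_nat n)) (C1 - B1)
          ** matrix_inv (mBeta B1 (C1 - B1))))"

end

theory Submission
  imports Defs "HOL-Computational_Algebra.Fundamental_Theorem_Algebra"
begin

text \<open>
  The \<open>n\<close>-th derivative shifts the coefficients of the series by \<open>n\<close>, and
  \<open>(A\<^sub>1)\<^sub>n\<^sub>+\<^sub>m = (A\<^sub>1)\<^sub>n (A\<^sub>1 + n I)\<^sub>m\<close>. The extended beta factors agree on both sides, so what remains is
  the shift of the ordinary beta matrix, which follows from \<open>\<Gamma>(P + I) = P \<Gamma>(P)\<close> and the invertibility
  of \<open>\<Gamma>(P)\<close>. The functional equation is an integration by parts; it needs the decay of
  \<open>t\<^sup>P\<close> at 0, which is obtained from a product \<open>(P - l\<^sub>1 I) \<dots> (P - l\<^sub>k I) = 0\<close> by induction on \<open>k\<close>.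
  \<open>\<Gamma>(P)\<close> is invertible because its kernel is \<open>P\<close>-invariant, hence would contain
  an eigenvector of \<open>P\<close>, on which \<open>\<Gamma>(P)\<close> acts as the nonzero number \<open>\<Gamma>(l)\<close>. For convergence only
  the boundedness in \<open>n\<close> of the extended beta factors matters.
\<close>

section \<open>Matrix algebra\<close>

text \<open>In finite dimension every bilinear map is bounded. This supplies the product rule,
  continuity, and the exchange of multiplication with series and integrals for
  \<open>**\<close>.\<close>

interpretation matrix_mult: bounded_bilinear "(**) :: complex^'r^'r \<Rightarrow> complex^'r^'r \<Rightarrow> complex^'r^'r"
proof -
  have "bilinear ((**) :: complex^'r^'r \<Rightarrow> complex^'r^'r \<Rightarrow> complex^'r^'r)"
    unfolding bilinear_def
    by (auto intro!: linearI simp: vec_eq_iff matrix_matrix_mult_def distrib_left distrib_right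
        sum.distrib scaleR_sum_right)
  thus "bounded_bilinear ((**) :: complex^'r^'r \<Rightarrow> complex^'r^'r \<Rightarrow> complex^'r^'r)"
    by (simp add: bilinear_conv_bounded_bilinear)
qed

interpretation matrix_vector: bounded_bilinear "(*v) :: complex^'r^'r \<Rightarrow> complex^'r \<Rightarrow> complex^'r"
proof -
  have "bilinear ((*v) :: complex^'r^'r \<Rightarrow> complex^'r \<Rightarrow> complex^'r)"
    unfolding bilinear_def
    by (auto intro!: linearI simp: vec_eq_iff matrix_vector_mult_def distrib_left distrib_right
        sum.distrib scaleR_sum_right)
  thus "bounded_bilinear ((*v) :: complex^'r^'r \<Rightarrow> complex^'r \<Rightarrow> complex^'r)"
    by (simp add: bilinear_conv_bounded_bilinear)
qed

lemma bounded_linear_mat: "bounded_linear (mat :: complex \<Rightarrow> complex^'r^'r)"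
  by (intro linear_conv_bounded_linear[THEN iffD1] linearI) (auto simp: mat_def vec_eq_iff)

lemma bounded_linear_vec_nth2: "bounded_linear (\<lambda>M :: complex^'r^'r. M $ i $ j)"
  using bounded_linear_compose[OF bounded_linear_vec_nth bounded_linear_vec_nth] .

lemma bounded_linear_vector_scale: "bounded_linear (\<lambda>c. c *s (v :: complex^'r))"
  by (intro linear_conv_bounded_linear[THEN iffD1] linearI) (auto simp: vec_eq_iff algebra_simps)

lemma mscale_nth: "mscale x X $ i $ j = x * X $ i $ j"
  by (simp add: mscale_def)

lemma norm_mscale: "norm (mscale x X) = cmod x * norm X"
  by (simp add: mscale_def norm_vec_def L2_set_def norm_mult
      power_mult_distrib sum_distrib_left[symmetric] real_sqrt_mult)

lemma mat_mult_eq_mscale: "mat c ** M = mscale c M"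
  by (simp add: vec_eq_iff mat_def mscale_def matrix_matrix_mult_def if_distrib if_distribR cong: if_cong)

lemma mat_mult_commute: "M ** mat c = mat c ** (M :: complex^'r^'r)"
  by (simp add: vec_eq_iff mat_def matrix_matrix_mult_def if_distrib if_distribR mult.commute cong: if_cong)

lemma mat_mult_mat: "mat a ** mat b = (mat (a * b) :: complex^'r^'r)"
  by (subst mat_mult_eq_mscale) (simp add: vec_eq_iff mat_def mscale_def)

lemma mat_add: "mat (a + b) = mat a + (mat b :: complex^'r^'r)"
  by (simp add: vec_eq_iff mat_def)

lemma mat_minus: "mat (- a) = - (mat a :: complex^'r^'r)"
  by (simp add: vec_eq_iff mat_def)

lemma mat_of_real_mult: "mat (of_real a) ** M = a *\<^sub>R (M :: complex^'r^'r)"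
  by (subst mat_mult_eq_mscale) (simp add: mscale_def vec_eq_iff scaleR_conv_of_real[where 'a=complex])

lemma mat_mult_vec: "mat c *v v = c *s (v :: complex^'r)"
  by (simp add: vec_eq_iff mat_def matrix_vector_mult_def if_distrib if_distribR cong: if_cong)

section \<open>Inverses, kernels and commutation\<close>

lemma matrix_inv_inv:
  fixes X Y :: "complex^'r^'r"
  assumes XY: "X ** Y = mat 1"
  shows "X ** matrix_inv X = mat 1"
proof -
  have YX: "Y ** X = mat 1"
    by (rule iffD1[OF matrix_left_right_inverse XY])
  \<comment> \<open>\<open>matrix_inv\<close> is a choice among two-sided inverses; \<open>Y\<close>
    witnesses that one exists, because a one-sided inverse of a square matrix is two-sided.\<close>
  have "X ** matrix_inv X = mat 1 \<and> matrix_inv X ** X = mat 1"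
    unfolding matrix_inv_def using conjI[OF XY YX] by (rule someI)
  thus ?thesis ..
qed

lemma matrix_inv_eqI:
  fixes X Y :: "complex^'r^'r"
  assumes XY: "X ** Y = mat 1"
  shows "matrix_inv X = Y"
proof -
  have YX: "Y ** X = mat 1"
    by (rule iffD1[OF matrix_left_right_inverse XY])
  have "Y = Y ** (X ** matrix_inv X)" unfolding matrix_inv_inv[OF XY] matrix_mul_rid ..
  also have "\<dots> = matrix_inv X" unfolding matrix_mul_assoc YX matrix_mul_lid ..
  finally show ?thesis ..
qed

lemma matrix_inv_right: "invertible (X :: complex^'r^'r) \<Longrightarrow> X ** matrix_inv X = mat 1"
  using matrix_inv_eqI unfolding invertible_def by metis

lemma matrix_inv_left: "invertible (X :: complex^'r^'r) \<Longrightarrow> matrix_inv X ** X = mat 1"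
  by (rule iffD1[OF matrix_left_right_inverse matrix_inv_right])

lemma matrix_inv_mult:
  fixes X Y :: "complex^'r^'r"
  assumes "invertible X" "invertible Y"
  shows "matrix_inv (X ** Y) = matrix_inv Y ** matrix_inv X"
proof (rule matrix_inv_eqI)
  have "X ** Y ** (matrix_inv Y ** matrix_inv X) = X ** (Y ** matrix_inv Y) ** matrix_inv X"
    by (simp only: matrix_mul_assoc)
  thus "X ** Y ** (matrix_inv Y ** matrix_inv X) = mat 1"
    by (simp add: matrix_inv_right assms)
qed

lemma matrix_inv_commute:
  fixes X Y :: "complex^'r^'r"
  assumes "invertible X" "X ** Y = Y ** X"
  shows "matrix_inv X ** Y = Y ** matrix_inv X"
proof -
  have "matrix_inv X ** Y = matrix_inv X ** (Y ** X) ** matrix_inv X"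
    by (simp add: matrix_mul_assoc[symmetric] matrix_inv_right assms)
  also have "\<dots> = (matrix_inv X ** X) ** Y ** matrix_inv X"
    by (simp add: assms(2)[symmetric] matrix_mul_assoc)
  finally show ?thesis by (simp add: matrix_inv_left assms)
qed

lemma invertible_matrix_inv: "invertible (X :: complex^'r^'r) \<Longrightarrow> invertible (matrix_inv X)"
  using matrix_inv_left matrix_inv_right invertible_def by blast

lemma invertible_iff_ker:
  "invertible (X :: complex^'r^'r) \<longleftrightarrow> (\<forall>v. X *v v = 0 \<longrightarrow> v = 0)"
  unfolding matrix_left_invertible_ker[symmetric] invertible_def
  by (meson matrix_left_right_inverse[THEN iffD1])

lemma mult_commute_trans:
  fixes X Y Z :: "complex^'r^'r"
  assumes "Z ** X = X ** Z" "Z ** Y = Y ** Z"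
  shows "Z ** (X ** Y) = (X ** Y) ** Z"
  using assms by (metis matrix_mul_assoc)

lemma mpow_commute: "Z ** M = M ** Z \<Longrightarrow> Z ** mpow M n = mpow M n ** Z"
  by (induction n) (auto intro: mult_commute_trans)

lemma mpoch_commute:
  assumes "Z ** M = M ** Z"
  shows "Z ** mpoch M n = mpoch M n ** Z"
proof (induction n)
  case (Suc n)
  have "Z ** (M + mat (of_nat n)) = (M + mat (of_nat n)) ** Z"
    by (simp add: matrix_mult.add_left matrix_mult.add_right assms mat_mult_commute)
  with Suc show ?case by (simp add: mult_commute_trans)
qed simp

lemma mpow_scaleR: "mpow (s *\<^sub>R M) n = s ^ n *\<^sub>R mpow M n"
  by (induction n) (auto simp: matrix_mult.scaleR_left matrix_mult.scaleR_right mult.commute)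

lemma mpoch_add: "mpoch M (m + n) = mpoch M m ** mpoch (M + mat (of_nat m)) n"
  by (induction n) (auto simp: matrix_mul_assoc mat_add add_ac)

section \<open>Positive stability under shifts\<close>

lemma positive_stable_add:
  assumes "positive_stable M" "x \<ge> 0"
  shows "positive_stable (M + mat (of_real x))"
  unfolding positive_stable_def
proof safe
  fix c v assume *: "v \<noteq> 0" "(M + mat (of_real x)) *v v = c *s v"
  hence "M *v v = (c - of_real x) *s v"
    by (simp add: matrix_vector.add_left mat_mult_vec algebra_simps vector_sadd_rdistrib vec_eq_iff)
  with assms(1) *(1) have "Re (c - of_real x) > 0" unfolding positive_stable_def by blast
  with assms(2) show "Re c > 0" by simp
qed

lemma positive_stable_add_nat: "positive_stable M \<Longrightarrow> positive_stable (M + mat (of_nat n))"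
  using positive_stable_add[of M "real n"] by simp

text \<open>A nonzero kernel vector would be an eigenvector with eigenvalue 0, whose real part is
  not positive.\<close>

lemma positive_stable_invertible: "positive_stable M \<Longrightarrow> invertible M"
  unfolding invertible_iff_ker positive_stable_def by (metis less_irrefl vector_smult_lzero zero_complex.sel(1))

lemma positive_stable_mpoch_invertible: "positive_stable M \<Longrightarrow> invertible (mpoch M n)"
proof (induction n)
  case 0
  show ?case by (auto simp: invertible_def intro!: exI[of _ "mat 1"])
next
  case (Suc n)
  thus ?case by (simp add: invertible_mult positive_stable_invertible positive_stable_add_nat)
qed

section \<open>Annihilating products\<close>

text \<open>Horner evaluation with respect to \<open>**\<close>; \<open>poly\<close> would use the
  entrywise product instead.\<close>

definition peval :: "complex^'r^'r \<Rightarrow> complex poly \<Rightarrow> complex^'r^'r" where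
  "peval M p = fold_coeffs (\<lambda>a X. mat a + M ** X) p 0"

lemma peval_0 [simp]: "peval M 0 = 0"
  by (simp add: peval_def)

lemma peval_pCons [simp]: "peval M (pCons a p) = mat a + M ** peval M p"
  by (cases "p = 0 \<and> a = 0") (auto simp: peval_def)

lemma peval_add: "peval M (p + q) = peval M p + peval M q"
  by (induction p q rule: poly_induct2) (auto simp: matrix_mult.add_right mat_add)

lemma peval_sum: "peval M (sum f S) = (\<Sum>i\<in>S. peval M (f i))"
  by (induction S rule: infinite_finite_induct) (auto simp: peval_add)

lemma peval_smult: "peval M (smult c p) = mat c ** peval M p"
proof (induction p)
  case (pCons a p)
  have "M ** (mat c ** peval M p) = mat c ** (M ** peval M p)"
    by (simp add: matrix_mul_assoc mat_mult_commute[of M])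
  with pCons show ?case by (simp add: matrix_mult.add_right mat_mult_mat)
qed simp

lemma peval_commute: "M ** peval M p = peval M p ** M"
proof (induction p)
  case (pCons a p)
  have "M ** (M ** peval M p) = M ** peval M p ** M"
    unfolding matrix_mul_assoc[symmetric] pCons(2)[symmetric] ..
  thus ?case by (simp add: matrix_mult.add_right matrix_mult.add_left mat_mult_commute[of M])
qed simp

lemma peval_monom: "peval M (monom c n) = mat c ** mpow M n"
proof (induction n)
  case (Suc n)
  have "peval M (monom c (Suc n)) = mat c ** (M ** mpow M n)"
    by (simp add: monom_Suc Suc matrix_mul_assoc mat_mult_commute[of M])
  thus ?case by (simp add: mpow_commute)
qed (simp add: monom_0)

text \<open>The space of matrices has finite dimension, so either two powers of \<open>M\<close>
  coincide or the infinitely many distinct powers are linearly dependent. The dependence has real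
  coefficients, which are then read as complex ones.\<close>

lemma ex_annihilating_poly: "\<exists>p. p \<noteq> 0 \<and> peval M p = 0"
proof (cases "inj (mpow M)")
  case False
  then obtain i j where ij: "i \<noteq> j" "mpow M i = mpow M j" by (auto simp: inj_def)
  let ?p = "monom 1 i + monom (-1) j :: complex poly"
  have "coeff ?p i = 1" using ij by simp
  hence "?p \<noteq> 0" by force
  moreover have "peval M ?p = 0"
    by (simp add: peval_add peval_monom ij mat_minus matrix_mult.minus_left)
  ultimately show ?thesis by blast
next
  case True
  hence "infinite (range (mpow M))" using finite_imageD by blast
  hence "dependent (range (mpow M))" using independent_imp_finite by blast
  then obtain t u v where t: "finite t" "t \<subseteq> range (mpow M)" "(\<Sum>X\<in>t. u X *\<^sub>R X) = 0" "v \<in> t" "u v \<noteq> 0"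
    unfolding dependent_explicit by blast
  define T where "T = mpow M -` t"
  have tT: "t = mpow M ` T" using t unfolding T_def by auto
  have fin: "finite T" unfolding T_def using t True by (simp add: finite_vimageI)
  let ?p = "\<Sum>i\<in>T. monom (of_real (u (mpow M i))) i :: complex poly"
  obtain k where k: "k \<in> T" "v = mpow M k" using t tT by auto
  have "coeff ?p k = of_real (u v)"
    using k fin by (simp add: coeff_sum sum.delta)
  hence p0: "?p \<noteq> 0" using t by force
  have "peval M ?p = (\<Sum>i\<in>T. u (mpow M i) *\<^sub>R mpow M i)"
    by (simp add: peval_sum peval_monom mat_of_real_mult)
  also have "\<dots> = 0"
    using t(3) True unfolding tT by (subst (asm) sum.reindex) (auto intro: inj_on_subset)
  finally show ?thesis using p0 by blast
qed

text \<open>The list holds roots with multiplicity. Its head gives the rightmost factor, hence the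
  first one applied to a vector, which suits induction on the list.\<close>

primrec shift_prod :: "complex^'r^'r \<Rightarrow> complex list \<Rightarrow> complex^'r^'r" where
  "shift_prod M [] = mat 1"
| "shift_prod M (l # ls) = shift_prod M ls ** (M - mat l)"

lemma shift_prod_commute: "Z ** M = M ** Z \<Longrightarrow> Z ** shift_prod M ls = shift_prod M ls ** Z"
proof (induction ls)
  case (Cons l ls)
  have "Z ** (M - mat l) = (M - mat l) ** Z"
    by (simp add: matrix_mult.diff_left matrix_mult.diff_right Cons mat_mult_commute)
  with Cons show ?case by (simp add: mult_commute_trans)
qed simp

text \<open>Over the complex numbers a root can be split off repeatedly, by induction on the degree;
  \<open>c\<close> is what remains as a constant.\<close>

lemma peval_eq_shift_prod:
  assumes "p \<noteq> 0"
  shows "\<exists>c ls. c \<noteq> 0 \<and> peval M p = mat c ** shift_prod M ls"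
  using assms
proof (induction "degree p" arbitrary: p)
  case 0
  then obtain c where "p = [:c:]" "c \<noteq> 0" by (metis degree_eq_zeroE pCons_0_0)
  thus ?case by (intro exI[of _ c] exI[of _ "[]"]) auto
next
  case (Suc n)
  obtain l where "poly p l = 0" using alg_closed_imp_poly_has_root[of p] Suc(2) by auto
  then obtain q where q: "p = [:-l, 1:] * q" by (auto simp: poly_eq_0_iff_dvd)
  have q0: "q \<noteq> 0" using Suc q by auto
  have "degree p = Suc (degree q)"
    using q0 unfolding q by (subst degree_mult_eq) auto
  then obtain c ls where c: "c \<noteq> 0" "peval M q = mat c ** shift_prod M ls"
    using Suc(1)[of q] q0 Suc(2) by auto
  have "peval M p = mat (-l) ** peval M q + M ** peval M q"
    unfolding q by (simp add: peval_add peval_smult del: smult_minus_left)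
  also have "mat (- l) ** peval M q + M ** peval M q = peval M q ** (M - mat l)"
    by (simp add: mat_minus matrix_mult.minus_left matrix_mult.diff_right peval_commute mat_mult_commute[of "peval M q"])
  also have "\<dots> = mat c ** shift_prod M (l # ls)" by (simp add: c matrix_mul_assoc)
  finally show ?case using c by blast
qed

lemma ex_shift_prod_eq_0: "\<exists>ls. shift_prod M ls = 0"
proof -
  obtain p where p: "p \<noteq> 0" "peval M p = 0" using ex_annihilating_poly by blast
  then obtain c ls where c: "c \<noteq> 0" "mat c ** shift_prod M ls = 0"
    using peval_eq_shift_prod[of p M] by auto
  have "mat (1/c) ** (mat c ** shift_prod M ls) = shift_prod M ls"
    unfolding matrix_mul_assoc mat_mult_mat using c(1) by simp
  with c(2) have "shift_prod M ls = 0" by simp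
  thus ?thesis ..
qed

text \<open>The kernel of \<open>N\<close> is invariant under \<open>M\<close>. Applying the factors
  of an annihilating product to \<open>v\<close> one at a time, the last nonzero vector is an
  eigenvector of \<open>M\<close> and still lies in that kernel.\<close>

lemma ex_eigenvector_in_kernel:
  fixes M N :: "complex^'r^'r"
  assumes "M ** N = N ** M" "N *v v = 0" "v \<noteq> 0"
  shows "\<exists>c w. w \<noteq> 0 \<and> N *v w = 0 \<and> M *v w = c *s w"
proof -
  have "\<exists>c w. w \<noteq> 0 \<and> N *v w = 0 \<and> M *v w = c *s w"
    if "shift_prod M ls *v v = 0" "N *v v = 0" "v \<noteq> 0" for ls v
    using that
  proof (induction ls arbitrary: v)
    case (Cons l ls)
    let ?w = "(M - mat l) *v v"
    show ?case
    proof (cases "?w = 0")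
      case True
      hence "M *v v = l *s v" by (simp add: matrix_vector.diff_left mat_mult_vec)
      thus ?thesis using Cons by blast
    next
      case False
      have "N ** (M - mat l) = (M - mat l) ** N"
        by (simp add: matrix_mult.diff_left matrix_mult.diff_right assms mat_mult_commute)
      hence "N *v ?w = (M - mat l) *v (N *v v)" by (simp only: matrix_vector_mul_assoc)
      hence "N *v ?w = 0" by (simp add: Cons)
      moreover have "shift_prod M ls *v ?w = 0"
        using Cons(2) by (simp add: matrix_vector_mul_assoc)
      ultimately show ?thesis using Cons(1) False by blast
    qed
  qed simp
  moreover obtain ls where "shift_prod M ls = 0" using ex_shift_prod_eq_0 by blast
  ultimately show ?thesis using assms by (metis matrix_vector.zero_left)
qed

section \<open>The matrix exponential\<close>

lemma norm_mpow_le: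
  "\<exists>K>0. \<exists>C\<ge>0. \<forall>n. norm (mpow (M :: complex^'r^'r) n) \<le> C * K ^ n"
proof -
  obtain K where K: "K > 0" "\<And>(a :: complex^'r^'r) (b :: complex^'r^'r). norm (a ** b) \<le> norm a * norm b * K"
    using matrix_mult.pos_bounded[where 'r = 'r] by blast
  \<comment> \<open>The constant \<open>K\<close> of the bilinear bound stands in for
    submultiplicativity of the norm; adding 1 keeps \<open>L\<close> positive when \<open>M\<close>
    is zero.\<close>
  define L where "L = norm M * K + 1"
  have L: "L > 0" "norm M * K \<le> L" using K by (auto simp: L_def intro: add_nonneg_pos)
  have "norm (mpow M n) \<le> norm (mat 1 :: complex^'r^'r) * L ^ n" for n
  proof (induction n)
    case (Suc n)
    have "norm (mpow M (Suc n)) \<le> norm (mpow M n) * (norm M * K)"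
      using K(2)[of "mpow M n" M] by (simp add: mult_ac)
    also have "\<dots> \<le> norm (mat 1 :: complex^'r^'r) * L ^ n * L"
      using Suc L K by (intro mult_mono) auto
    finally show ?case by (simp add: mult_ac)
  qed simp
  thus ?thesis using L(1) norm_ge_zero by blast
qed

lemma summable_norm_mexp: "summable (\<lambda>n. norm ((1 / fact n) *\<^sub>R mpow (M :: complex^'r^'r) n))"
proof -
  obtain K C where K: "\<And>n. norm (mpow M n) \<le> C * K ^ n" using norm_mpow_le by blast
  have "summable (\<lambda>n. C * (K ^ n /\<^sub>R fact n))"
    by (intro summable_mult summable_exp_generic)
  thus ?thesis
  proof (rule summable_comparison_test')
    fix n
    show "norm (norm ((1 / fact n) *\<^sub>R mpow M n)) \<le> C * (K ^ n /\<^sub>R fact n)"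
      using divide_right_mono[OF K[of n], of "fact n"] by (simp add: divide_inverse mult_ac)
  qed
qed

lemmas summable_mexp = summable_norm_cancel[OF summable_norm_mexp]

lemma mexp_sums: "(\<lambda>n. (1 / fact n) *\<^sub>R mpow M n) sums mexp M"
  unfolding mexp_def by (rule summable_sums[OF summable_mexp])

lemma mexp_0 [simp]: "mexp 0 = mat 1"
proof -
  have "(\<lambda>n. (1 / fact n) *\<^sub>R mpow 0 n) sums (\<Sum>n\<in>{0}. (1 / fact n) *\<^sub>R (mpow 0 n :: complex^'a^'a))"
  proof (rule sums_finite)
    fix n :: nat assume "n \<notin> {0}"
    then obtain m where "n = Suc m" by (cases n) auto
    thus "(1 / fact n) *\<^sub>R (mpow 0 n :: complex^'a^'a) = 0" by (simp add: matrix_mult.zero_right)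
  qed simp
  from sums_unique2[OF mexp_sums this] show ?thesis by simp
qed

lemma mexp_commute:
  assumes "Z ** M = M ** Z"
  shows "Z ** mexp M = mexp M ** Z"
proof -
  have "(\<lambda>n. Z ** ((1 / fact n) *\<^sub>R mpow M n)) sums (Z ** mexp M)"
    by (rule bounded_linear.sums[OF matrix_mult.bounded_linear_right mexp_sums])
  moreover have "(\<lambda>n. ((1 / fact n) *\<^sub>R mpow M n) ** Z) sums (mexp M ** Z)"
    by (rule bounded_linear.sums[OF matrix_mult.bounded_linear_left mexp_sums])
  ultimately show ?thesis
    by (simp add: matrix_mult.scaleR_left matrix_mult.scaleR_right mpow_commute[OF assms] sums_unique2)
qed

lemma mexp_eigenvector:
  assumes "M *v v = c *s v"
  shows "mexp M *v v = exp c *s (v :: complex^'r)"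
proof -
  have *: "mpow M n *v v = c ^ n *s v" for n
    by (induction n) (auto simp: matrix_vector_mul_assoc[symmetric] assms vec.scale mult.commute)
  have "(\<lambda>n. ((1 / fact n) *\<^sub>R mpow M n) *v v) sums (mexp M *v v)"
    by (rule bounded_linear.sums[OF matrix_vector.bounded_linear_left mexp_sums])
  also have "(\<lambda>n. ((1 / fact n) *\<^sub>R mpow M n) *v v) = (\<lambda>n. (c ^ n /\<^sub>R fact n) *s v)"
    by (simp add: matrix_vector.scaleR_left * vec_eq_iff fun_eq_iff divide_inverse)
  finally have "(\<lambda>n. (c ^ n /\<^sub>R fact n) *s v) sums (mexp M *v v)" .
  moreover have "(\<lambda>n. (c ^ n /\<^sub>R fact n) *s v) sums (exp c *s v)"
    by (rule bounded_linear.sums[OF bounded_linear_vector_scale exp_converges])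
  ultimately show ?thesis by (rule sums_unique2)
qed

section \<open>The differential equation of the exponential\<close>

lemma has_vector_derivative_vecI:
  fixes f :: "real \<Rightarrow> 'a::euclidean_space ^ 'n"
  assumes "\<And>i. ((\<lambda>x. f x $ i) has_vector_derivative f' $ i) (at a within S)"
  shows "(f has_vector_derivative f') (at a within S)"
  unfolding has_vector_derivative_def
proof (rule has_derivative_componentwise_within[THEN iffD2], rule)
  fix e :: "'a^'n" assume "e \<in> Basis"
  then obtain i b where e: "e = axis i b" by (auto simp: Basis_vec_def)
  show "((\<lambda>x. f x \<bullet> e) has_derivative (\<lambda>x. x *\<^sub>R f' \<bullet> e)) (at a within S)"
    using has_derivative_inner_left[OF assms[of i, unfolded has_vector_derivative_def], of b]
    by (simp add: e inner_axis)
qed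

text \<open>Each entry of \<open>mexp (s *\<^sub>R M)\<close> is a scalar power series in
  \<open>s\<close> with coefficients \<open>a n\<close>. Differentiating it term by term yields the
  coefficients \<open>diffs a\<close>, which are those of the entry of
  \<open>M ** mexp (s *\<^sub>R M)\<close>.\<close>

lemma mexp_has_vector_derivative:
  fixes M :: "complex^'r^'r"
  shows "((\<lambda>s. mexp (s *\<^sub>R M)) has_vector_derivative (M ** mexp (s *\<^sub>R M))) (at s within S)"
proof (intro has_vector_derivative_vecI)
  fix i j
  define a where "a n = (mpow M n $ i $ j) / fact n" for n
  have entry: "(\<lambda>n. a n * of_real x ^ n) sums (mexp (x *\<^sub>R M) $ i $ j)" for x
  proof -
    have "(\<lambda>n. ((1 / fact n) *\<^sub>R mpow (x *\<^sub>R M) n) $ i $ j) sums (mexp (x *\<^sub>R M) $ i $ j)"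
      by (rule bounded_linear.sums[OF bounded_linear_vec_nth2 mexp_sums])
    thus ?thesis
      by (simp add: a_def mpow_scaleR scaleR_conv_of_real[where 'a = complex] mult_ac)
  qed
  have entry': "(\<lambda>n. diffs a n * of_real x ^ n) sums ((M ** mexp (x *\<^sub>R M)) $ i $ j)" for x
  proof -
    have "(\<lambda>n. (M ** ((1 / fact n) *\<^sub>R mpow (x *\<^sub>R M) n)) $ i $ j) sums ((M ** mexp (x *\<^sub>R M)) $ i $ j)"
      by (intro bounded_linear.sums[OF bounded_linear_vec_nth2]
          bounded_linear.sums[OF matrix_mult.bounded_linear_right mexp_sums])
    moreover have "(M ** ((1 / fact n) *\<^sub>R mpow (x *\<^sub>R M) n)) $ i $ j = diffs a n * of_real x ^ n" for n
      by (simp add: a_def diffs_def mpow_scaleR matrix_mult.scaleR_right mpow_commute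
          scaleR_conv_of_real[where 'a = complex] field_simps del: of_nat_Suc)
    ultimately show ?thesis by simp
  qed
  have "((\<lambda>z. \<Sum>n. a n * z ^ n) has_field_derivative (\<Sum>n. diffs a n * of_real s ^ n)) (at (of_real s))"
  proof (rule termdiffs_strong)
    \<comment> \<open>The series converges everywhere; the radius only has to exceed the absolute
      value of \<open>s\<close>.\<close>
    show "summable (\<lambda>n. a n * of_real (\<bar>s\<bar> + 1) ^ n)" using entry by (rule sums_summable)
  qed (simp del: of_real_add)
  from has_vector_derivative_real_field[OF this]
  show "((\<lambda>s. mexp (s *\<^sub>R M) $ i $ j) has_vector_derivative (M ** mexp (s *\<^sub>R M)) $ i $ j) (at s within S)"
    using sums_unique[OF entry] sums_unique[OF entry'] by simp
qed

text \<open>By the product rule and \<open>mexp_commute\<close> the two terms of the derivative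
  cancel, so the product is constant and equals its value at 0.\<close>

lemma mexp_minus_mult_ode:
  fixes V :: "real \<Rightarrow> complex^'r^'r"
  assumes V: "\<And>s. (V has_vector_derivative M ** V s) (at s)" "V 0 = mat 1"
  shows "mexp ((- s) *\<^sub>R M) ** V s = mat 1"
proof -
  let ?g = "\<lambda>s. mexp ((- s) *\<^sub>R M) ** V s"
  have d: "((\<lambda>s. mexp ((- s) *\<^sub>R M)) has_vector_derivative (- 1) *\<^sub>R (M ** mexp ((- s) *\<^sub>R M))) (at s)" for s
    using mexp_has_vector_derivative[of "- M" s UNIV] by (simp add: matrix_mult.minus_left)
  have c: "mexp (x *\<^sub>R M) ** M = M ** mexp (x *\<^sub>R M)" for x
    by (rule mexp_commute[symmetric]) (simp add: matrix_mult.scaleR_left matrix_mult.scaleR_right)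
  have "(?g has_vector_derivative 0) (at s)" for s
    using matrix_mult.has_vector_derivative[OF d V(1), of s] c[of "- s"]
    by (simp add: matrix_mul_assoc matrix_mult.minus_left)
  hence "(?g has_derivative (\<lambda>h. 0)) (at s within UNIV)" for s
    by (simp add: has_vector_derivative_def)
  from has_derivative_zero_unique[OF convex_UNIV this, of s 0]
  show ?thesis using V(2) by simp
qed

lemma mexp_minus_mult: "mexp ((- s) *\<^sub>R M) ** mexp (s *\<^sub>R M) = mat 1"
  using mexp_minus_mult_ode[OF mexp_has_vector_derivative] by simp

lemma mexp_ode_unique:
  fixes U :: "real \<Rightarrow> complex^'r^'r"
  assumes "\<And>s. (U has_vector_derivative M ** U s) (at s)" "U 0 = mat 1"
  shows "U s = mexp (s *\<^sub>R M)"
proof -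
  have "mexp (s *\<^sub>R M) = mexp (s *\<^sub>R M) ** (mexp ((- s) *\<^sub>R M) ** U s)"
    using mexp_minus_mult_ode[OF assms] by simp
  also have "\<dots> = (mexp (s *\<^sub>R M) ** mexp ((- s) *\<^sub>R M)) ** U s"
    by (simp only: matrix_mul_assoc)
  also have "mexp (s *\<^sub>R M) ** mexp ((- s) *\<^sub>R M) = mat 1"
    using mexp_minus_mult[of "- s" M] by simp
  finally show ?thesis by simp
qed

text \<open>The right-hand side solves the initial value problem that characterizes the left-hand
  side, so no Cauchy product of exponential series arises.\<close>

lemma mexp_add_mat:
  "mexp (s *\<^sub>R (M + mat (of_real c))) = exp (c * s) *\<^sub>R mexp (s *\<^sub>R (M :: complex^'r^'r))"
proof (rule mexp_ode_unique[symmetric])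
  fix s
  have *: "(exp (c * s) *\<^sub>R (M ** mexp (s *\<^sub>R M)) + (c * exp (c * s)) *\<^sub>R mexp (s *\<^sub>R M))
     = (M + mat (of_real c)) ** exp (c * s) *\<^sub>R mexp (s *\<^sub>R M)"
    by (simp add: matrix_mult.add_left matrix_mult.scaleR_right mat_of_real_mult scaleR_add_right mult.commute)
  show "((\<lambda>s. exp (c * s) *\<^sub>R mexp (s *\<^sub>R M)) has_vector_derivative
      (M + mat (of_real c)) ** exp (c * s) *\<^sub>R mexp (s *\<^sub>R M)) (at s)"
    unfolding *[symmetric]
    by (intro has_vector_derivative_scaleR mexp_has_vector_derivative)
      (auto intro!: derivative_eq_intros)
qed simp

text \<open>
  Duhamel's formula: with \<open>V' = (M - l) V\<close>, the function \<open>e\<^sup>-\<^sup>l\<^sup>s exp (s M) V\<close> has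
  derivative \<open>e\<^sup>-\<^sup>l\<^sup>s exp (s M) V'\<close>, and \<open>V'\<close> is annihilated by one factor less.
\<close>
lemma norm_mexp_le_aux:
  fixes M V :: "complex^'r^'r"
  assumes "positive_stable M" "shift_prod M ls ** V = 0"
  shows "\<exists>d>0. \<exists>C\<ge>0. \<forall>s\<le>0. norm (mexp (s *\<^sub>R M) ** V) \<le> C * exp (d * s)"
  using assms(2)
proof (induction ls arbitrary: V)
  case Nil
  thus ?case by (intro exI[of _ 1] exI[of _ 0] conjI) auto
next
  case (Cons l ls)
  show ?case
  \<comment> \<open>If \<open>l\<close> is not an eigenvalue, its factor is invertible and cancels
    from the product. Otherwise stability gives \<open>Re l > 0\<close> and Duhamel's formula
    applies.\<close>
  proof (cases "\<forall>v. (M - mat l) *v v = 0 \<longrightarrow> v = 0")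
    case True
    hence inv: "invertible (M - mat l)" by (simp add: invertible_iff_ker)
    have "shift_prod M ls ** (M - mat l) = (M - mat l) ** shift_prod M ls"
      by (rule shift_prod_commute[symmetric])
        (simp add: matrix_mult.diff_left matrix_mult.diff_right mat_mult_commute[of M])
    hence "(M - mat l) ** (shift_prod M ls ** V) = 0"
      using Cons.prems by (simp add: matrix_mul_assoc)
    hence "matrix_inv (M - mat l) ** ((M - mat l) ** (shift_prod M ls ** V)) = 0" by simp
    hence "shift_prod M ls ** V = 0"
      unfolding matrix_mul_assoc matrix_inv_left[OF inv] by simp
    thus ?thesis by (rule Cons.IH)
  next
    case False
    then obtain v where v: "v \<noteq> 0" "(M - mat l) *v v = 0" by blast
    hence "M *v v = l *s v" by (simp add: matrix_vector.diff_left mat_mult_vec)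
    hence l: "Re l > 0" using assms(1) v by (auto simp: positive_stable_def)
    define W where "W = (M - mat l) ** V"
    have "shift_prod M ls ** W = 0" using Cons.prems by (simp add: W_def matrix_mul_assoc)
    from Cons.IH[OF this] obtain d0 C0 where
      d0: "d0 > 0" "C0 \<ge> 0" "\<And>s. s \<le> 0 \<Longrightarrow> norm (mexp (s *\<^sub>R M) ** W) \<le> C0 * exp (d0 * s)" by blast
    \<comment> \<open>Halving \<open>Re l\<close> makes \<open>d\<close> strictly smaller than it,
      so that the later division by \<open>Re l - d\<close> is legitimate even if \<open>d0\<close>
      equals \<open>Re l\<close>.\<close>
    define d where "d = min d0 (Re l / 2)"
    have d: "d > 0" "d < Re l" "d \<le> d0" using d0 l by (auto simp: d_def)
    have dW: "norm (mexp (s *\<^sub>R M) ** W) \<le> C0 * exp (d * s)" if "s \<le> 0" for s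
    proof -
      have "d0 * s \<le> d * s" using d(3) that by (intro mult_right_mono_neg) auto
      hence "C0 * exp (d0 * s) \<le> C0 * exp (d * s)" using d0 by (intro mult_left_mono) auto
      thus ?thesis using d0(3)[OF that] by linarith
    qed
    have m: "norm (mat x ** (X :: complex^'r^'r)) = cmod x * norm X" for x X
      by (simp add: mat_mult_eq_mscale norm_mscale)
    let ?u = "\<lambda>s. mexp (s *\<^sub>R M) ** V"
    let ?f = "\<lambda>s. mat (exp (- (l * of_real s))) ** ?u s"
    let ?f' = "\<lambda>s. mat (exp (- (l * of_real s))) ** (mexp (s *\<^sub>R M) ** W)"
    have f': "(?f has_vector_derivative ?f' s) (at s within S)" for s S
    proof -
      have 1: "((\<lambda>s. exp (- (l * of_real s))) has_vector_derivative (- l * exp (- (l * of_real s)))) (at s within S)"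
        by (rule has_vector_derivative_real_field[where f = "\<lambda>s. exp (- (l * s))"])
          (auto intro!: derivative_eq_intros)
      have 2: "((\<lambda>s. mat (exp (- (l * of_real s)))) has_vector_derivative
          (mat (- l * exp (- (l * of_real s))) :: complex^'r^'r)) (at s within S)"
        by (rule bounded_linear.has_vector_derivative[OF bounded_linear_mat 1])
      have 3: "(?u has_vector_derivative M ** mexp (s *\<^sub>R M) ** V) (at s within S)"
        by (rule bounded_linear.has_vector_derivative[OF matrix_mult.bounded_linear_left mexp_has_vector_derivative])
      have c: "M ** mexp (s *\<^sub>R M) = mexp (s *\<^sub>R M) ** M"
        by (rule mexp_commute) (simp add: matrix_mult.scaleR_left matrix_mult.scaleR_right)
      have "mexp (s *\<^sub>R M) ** W = mexp (s *\<^sub>R M) ** M ** V - mat l ** (mexp (s *\<^sub>R M) ** V)"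
        by (simp add: W_def matrix_mult.diff_left matrix_mult.diff_right matrix_mul_assoc
            mat_mult_commute[of "mexp (s *\<^sub>R M)"])
      hence "?f' s = mat (exp (- (l * of_real s))) ** (M ** mexp (s *\<^sub>R M) ** V)
          - mat (l * exp (- (l * of_real s))) ** ?u s"
        by (simp add: c matrix_mult.diff_right matrix_mul_assoc mat_mult_mat mult.commute)
      also have "\<dots> = mat (exp (- (l * of_real s))) ** (M ** mexp (s *\<^sub>R M) ** V)
          + mat (- l * exp (- (l * of_real s))) ** ?u s"
        by (simp add: mat_minus matrix_mult.minus_left)
      finally show ?thesis
        using matrix_mult.has_vector_derivative[OF 2 3] by simp
    qed
    have bd: "norm (?u s) \<le> (norm V + C0 / (Re l - d)) * exp (d * s)" if s: "s \<le> 0" for s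
    proof (cases "s = 0")
      case False
      define a where "a = Re l - d"
      have a: "a > 0" using d by (simp add: a_def)
      have exp_a: "exp (- (Re l * x)) * exp (d * x) = exp (- (a * x))" for x
        by (simp add: a_def mult_exp_exp algebra_simps)
      \<comment> \<open>An antiderivative of the bound \<open>C0 * exp (- (a * x))\<close> on the
        norm of \<open>?f'\<close>; the mean value inequality on the interval from \<open>s\<close>
        to 0 then compares \<open>?f\<close> with its value \<open>V\<close> at 0.\<close>
      let ?p = "\<lambda>x. - (C0 / a) * exp (- (a * x))"
      have "norm (?f 0 - ?f s) \<le> ?p 0 - ?p s"
      proof (rule differentiable_bound_general[where f = ?f and \<phi> = ?p and a = s and b = 0 and f' = ?f' and \<phi>' = "\<lambda>x. C0 * exp (- (a * x))"])
        show "continuous_on {s..0} ?f"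
          by (rule continuous_on_vector_derivative[OF f'])
        show "continuous_on {s..0} ?p" by (intro continuous_intros)
        show "(?p has_vector_derivative C0 * exp (- (a * x))) (at x)" for x
          unfolding has_real_derivative_iff_has_vector_derivative[symmetric]
          using a by (auto intro!: derivative_eq_intros)
        show "norm (?f' x) \<le> C0 * exp (- (a * x))" if "x < 0" for x
        proof -
          have "norm (?f' x) = exp (- (Re l * x)) * norm (mexp (x *\<^sub>R M) ** W)"
            by (simp add: m)
          also have "\<dots> \<le> exp (- (Re l * x)) * (C0 * exp (d * x))"
            using that by (intro mult_left_mono dW) auto
          also have "\<dots> = C0 * exp (- (a * x))" by (simp add: exp_a[symmetric])
          finally show ?thesis .
        qed
        show "(?f has_vector_derivative ?f' x) (at x)" for x by (rule f')
      qed (use s False in auto)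
      also have "\<dots> \<le> C0 / a * exp (- (a * s))" using d0 a by simp
      finally have "norm (?f s) \<le> norm V + C0 / a * exp (- (a * s))"
        using norm_triangle_sub[of "?f s" V] by (simp add: norm_minus_commute)
      \<comment> \<open>Since \<open>s\<close> is nonpositive, the exponential is at least 1 and the
        constant term can be absorbed into it.\<close>
      moreover have "norm V * 1 \<le> norm V * exp (- (a * s))"
        using s a by (intro mult_left_mono) (auto simp: mult_nonneg_nonpos)
      ultimately have "norm (?f s) \<le> (norm V + C0 / a) * exp (- (a * s))"
        unfolding distrib_right by linarith
      hence *: "exp (- (Re l * s)) * norm (?u s)
          \<le> exp (- (Re l * s)) * ((norm V + C0 / a) * exp (d * s))"
        by (simp add: m exp_a[symmetric] mult_ac)
      show ?thesis unfolding a_def[symmetric]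
        by (rule mult_left_le_imp_le[OF *]) simp
    qed (use d d0 in auto)
    show ?thesis
    proof (intro exI conjI allI impI)
      show "norm V + C0 / (Re l - d) \<ge> 0" using d d0 by simp
    qed (use bd d in auto)
  qed
qed

lemma norm_mexp_le:
  fixes M :: "complex^'r^'r"
  assumes "positive_stable M"
  obtains d C where "d > 0" "C \<ge> 0" "\<And>s. s \<le> 0 \<Longrightarrow> norm (mexp (s *\<^sub>R M)) \<le> C * exp (d * s)"
proof -
  obtain ls where "shift_prod M ls = 0" using ex_shift_prod_eq_0 by blast
  hence "shift_prod M ls ** mat 1 = 0" by simp
  from norm_mexp_le_aux[OF assms this] that show thesis by auto
qed

text \<open>The geometric bound on the powers of \<open>M\<close> dominates the exponential series
  by \<open>C\<close> times the real series of \<open>exp (K * s)\<close>.\<close>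

lemma norm_mexp_le_pos:
  fixes M :: "complex^'r^'r"
  obtains k C where "k > 0" "C \<ge> 0" "\<And>s. s \<ge> 0 \<Longrightarrow> norm (mexp (s *\<^sub>R M)) \<le> C * exp (k * s)"
proof -
  obtain K C where K: "K > 0" "C \<ge> 0" "\<And>n. norm (mpow M n) \<le> C * K ^ n" using norm_mpow_le by blast
  have "norm (mexp (s *\<^sub>R M)) \<le> C * exp (K * s)" if "s \<ge> 0" for s
  proof -
    have "norm (mexp (s *\<^sub>R M)) \<le> (\<Sum>n. norm ((1 / fact n) *\<^sub>R mpow (s *\<^sub>R M) n))"
      unfolding mexp_def by (rule summable_norm[OF summable_norm_mexp])
    also have "\<dots> \<le> (\<Sum>n. C * ((K * s) ^ n /\<^sub>R fact n))"
    proof (rule suminf_le[OF _ summable_norm_mexp])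
      show "summable (\<lambda>n. C * ((K * s) ^ n /\<^sub>R fact n))"
        by (intro summable_mult summable_exp_generic)
      fix n
      have "s ^ n * norm (mpow M n) \<le> s ^ n * (C * K ^ n)"
        using that K by (intro mult_left_mono) auto
      thus "norm ((1 / fact n) *\<^sub>R mpow (s *\<^sub>R M) n) \<le> C * ((K * s) ^ n /\<^sub>R fact n)"
        using that by (simp add: mpow_scaleR field_simps power_mult_distrib)
    qed
    also have "\<dots> = C * exp (K * s)"
      by (subst suminf_mult[OF summable_exp_generic]) (simp add: exp_def)
    finally show ?thesis .
  qed
  with K that show thesis by blast
qed

section \<open>Real powers and the Gamma matrix function\<close>

lemma mpowr_add_mat:
  "t > 0 \<Longrightarrow> mpowr t (M + mat (of_real c)) = t powr c *\<^sub>R mpowr t (M :: complex^'r^'r)"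
  by (simp add: mpowr_def mexp_add_mat powr_def)

lemma mpowr_add_nat:
  "t > 0 \<Longrightarrow> mpowr t (M + mat (of_nat n)) = t ^ n *\<^sub>R mpowr t (M :: complex^'r^'r)"
  using mpowr_add_mat[of t M "real n"] by (simp add: powr_realpow)

lemma mpowr_diff_one:
  "t > 0 \<Longrightarrow> mpowr t (M - mat 1) = (1 / t) *\<^sub>R mpowr t (M :: complex^'r^'r)"
  using mpowr_add_mat[of t M "-1"] by (simp add: mat_minus powr_minus_divide)

lemma mpowr_commute: "Z ** M = M ** Z \<Longrightarrow> Z ** mpowr t M = mpowr t M ** Z"
  unfolding mpowr_def
  by (rule mexp_commute) (simp add: matrix_mult.scaleR_left matrix_mult.scaleR_right)

lemma mpowr_has_vector_derivative:
  fixes M :: "complex^'r^'r"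
  assumes "t > 0"
  shows "((\<lambda>t. mpowr t M) has_vector_derivative M ** mpowr t (M - mat 1)) (at t)"
proof -
  have "(ln has_vector_derivative 1 / t) (at t)"
    using assms unfolding has_real_derivative_iff_has_vector_derivative[symmetric]
    by (rule DERIV_ln_divide)
  from vector_diff_chain_at[OF this mexp_has_vector_derivative[of M]]
  show ?thesis
    unfolding mpowr_diff_one[OF assms] by (simp add: o_def mpowr_def matrix_mult.scaleR_right)
qed

text \<open>With \<open>s = ln t\<close> the exponential bounds for negative and positive
  \<open>s\<close> become power bounds near 0 and near infinity.\<close>

lemma mpowr_bounds:
  fixes M :: "complex^'r^'r"
  assumes "positive_stable M"
  obtains d n C where "d > 0" "n > 0" "C \<ge> 0"
    "\<And>t. 0 < t \<Longrightarrow> t \<le> 1 \<Longrightarrow> norm (mpowr t M) \<le> C * t powr d"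
    "\<And>t. t \<ge> 1 \<Longrightarrow> norm (mpowr t M) \<le> C * t ^ n"
proof -
  obtain d C1 where d: "d > 0" "C1 \<ge> 0" "\<And>s. s \<le> 0 \<Longrightarrow> norm (mexp (s *\<^sub>R M)) \<le> C1 * exp (d * s)"
    using norm_mexp_le[OF assms] by metis
  obtain k C2 where k: "k > 0" "C2 \<ge> 0" "\<And>s. s \<ge> 0 \<Longrightarrow> norm (mexp (s *\<^sub>R M)) \<le> C2 * exp (k * s)"
    using norm_mexp_le_pos[of M] by metis
  \<comment> \<open>Rounding the growth rate up to a natural number prepares for the limit of
    \<open>t ^ n / exp t\<close> at infinity.\<close>
  define n where "n = nat \<lceil>k\<rceil>"
  define C where "C = max C1 C2"
  have n: "n > 0" "k \<le> real n" using k by (auto simp: n_def)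
  have "norm (mpowr t M) \<le> C * t powr d" if t: "0 < t" "t \<le> 1" for t
  proof -
    have "norm (mpowr t M) \<le> C1 * t powr d"
      using d(3)[of "ln t"] t by (simp add: mpowr_def powr_def)
    also have "\<dots> \<le> C * t powr d" by (intro mult_right_mono) (auto simp: C_def)
    finally show ?thesis .
  qed
  moreover have "norm (mpowr t M) \<le> C * t ^ n" if t: "t \<ge> 1" for t
  proof -
    have "norm (mpowr t M) \<le> C2 * t powr k"
      using k(3)[of "ln t"] t by (simp add: mpowr_def powr_def)
    also have "\<dots> \<le> C * t powr real n"
      using n t k by (intro mult_mono powr_mono) (auto simp: C_def)
    finally show ?thesis using t by (simp add: powr_realpow)
  qed
  ultimately show thesis using that[of d n C] d n by (auto simp: C_def)
qed

section \<open>The Gamma integral and its functional equation\<close>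

lemma set_integrable_Gamma_real:
  assumes "x > (0::real)"
  shows "set_integrable lborel {0<..} (\<lambda>t. t powr (x - 1) / exp t)"
proof -
  have "integrable lborel (\<lambda>t. indicator {0..} t * t powr (x - 1) / exp t)"
  proof (rule integrableI_nonneg)
    show "(\<integral>\<^sup>+ t. ennreal (indicator {0..} t * t powr (x - 1) / exp t) \<partial>lborel) < \<infinity>"
      unfolding Gamma_conv_nn_integral_real[OF assms, symmetric] by simp
  qed auto
  hence "set_integrable lborel {0..} (\<lambda>t. t powr (x - 1) / exp t)"
    unfolding set_integrable_def by simp
  thus ?thesis by (rule set_integrable_subset) auto
qed

lemma isCont_Gamma_integrand:
  "t > 0 \<Longrightarrow> isCont (\<lambda>t. exp (- t) *\<^sub>R mpowr t (M :: complex^'r^'r)) t"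
  by (intro continuous_intros has_vector_derivative_continuous[OF mpowr_has_vector_derivative]) auto

lemma set_integrable_mGamma:
  fixes P :: "complex^'r^'r"
  assumes "positive_stable P"
  shows "set_integrable lborel {0<..} (\<lambda>t. exp (- t) *\<^sub>R mpowr t (P - mat 1))"
proof -
  obtain d n C where b: "d > 0" "n > 0" "C \<ge> 0"
    "\<And>t. 0 < t \<Longrightarrow> t \<le> 1 \<Longrightarrow> norm (mpowr t P) \<le> C * t powr d"
    "\<And>t. t \<ge> 1 \<Longrightarrow> norm (mpowr t P) \<le> C * t ^ n"
    using mpowr_bounds[OF assms] by metis
  \<comment> \<open>A sum of two real Gamma integrands: the one with parameter \<open>d\<close>
    dominates on (0,1], the one with parameter \<open>n\<close> beyond 1.\<close>
  let ?g = "\<lambda>t. C * (t powr (d - 1) / exp t) + C * (t powr (real n - 1) / exp t)"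
  have "set_integrable lborel {0<..} ?g"
    using b by (intro set_integral_add set_integrable_mult_right set_integrable_Gamma_real) auto
  thus ?thesis
  proof (rule set_integrable_bound)
    have "continuous_on {0<..} (\<lambda>t. exp (- t) *\<^sub>R mpowr t (P - mat 1))"
      by (intro continuous_at_imp_continuous_on ballI isCont_Gamma_integrand) auto
    hence "(\<lambda>t. indicator {0<..} t *\<^sub>R (exp (- t) *\<^sub>R mpowr t (P - mat 1))) \<in> borel_measurable borel"
      by (rule borel_measurable_continuous_on_indicator[rotated]) simp
    thus "set_borel_measurable lborel {0<..} (\<lambda>t. exp (- t) *\<^sub>R mpowr t (P - mat 1))"
      by (simp add: set_borel_measurable_def)
    have "norm (exp (- t) *\<^sub>R mpowr t (P - mat 1)) \<le> norm (?g t)" if t: "t > 0" for t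
    proof -
      have "norm (mpowr t P) \<le> C * t powr d + C * t powr real n"
      proof (cases "t \<le> 1")
        case True
        thus ?thesis using b(4)[of t] t b(3) by (simp add: add_increasing2)
      next
        case False
        thus ?thesis using b(5)[of t] t b(3) by (simp add: add_increasing powr_realpow)
      qed
      hence "norm (mpowr t P) / (t * exp t) \<le> (C * t powr d + C * t powr real n) / (t * exp t)"
        using t by (intro divide_right_mono) auto
      also have "\<dots> = ?g t" using t by (simp add: powr_diff field_simps)
      also have "\<dots> \<le> norm (?g t)" by simp
      finally show ?thesis using t by (simp add: mpowr_diff_one exp_minus divide_inverse mult_ac)
    qed
    thus "AE t in lborel. t \<in> {0<..} \<longrightarrow> norm (exp (- t) *\<^sub>R mpowr t (P - mat 1)) \<le> norm (?g t)"
      by (intro always_eventually allI impI) auto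
  qed
qed

lemma set_integral_bounded_linear:
  assumes "bounded_linear T" "set_integrable M A f"
  shows "(LINT x:A|M. T (f x)) = T (LINT x:A|M. f x)" "set_integrable M A (\<lambda>x. T (f x))"
proof -
  interpret bounded_linear T by fact
  show "(LINT x:A|M. T (f x)) = T (LINT x:A|M. f x)" "set_integrable M A (\<lambda>x. T (f x))"
    using integral_bounded_linear[OF assms(1) assms(2)[unfolded set_integrable_def]]
      integrable_bounded_linear[OF assms(1) assms(2)[unfolded set_integrable_def]]
    by (simp_all add: set_lebesgue_integral_def set_integrable_def scaleR)
qed

lemma mGamma_commute:
  fixes P :: "complex^'r^'r"
  assumes "positive_stable P" "Z ** P = P ** Z"
  shows "Z ** mGamma P = mGamma P ** Z"
proof -
  have "Z ** (P - mat 1) = (P - mat 1) ** Z"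
    by (simp add: matrix_mult.diff_left matrix_mult.diff_right assms)
  hence c: "Z ** (exp (- t) *\<^sub>R mpowr t (P - mat 1)) = (exp (- t) *\<^sub>R mpowr t (P - mat 1)) ** Z" for t
    by (simp add: mpowr_commute matrix_mult.scaleR_left matrix_mult.scaleR_right)
  show ?thesis
    unfolding mGamma_def
      set_integral_bounded_linear(1)[OF matrix_mult.bounded_linear_right set_integrable_mGamma[OF assms(1)], symmetric]
      set_integral_bounded_linear(1)[OF matrix_mult.bounded_linear_left set_integrable_mGamma[OF assms(1)], symmetric]
      c ..
qed

text \<open>Integration by parts: \<open>?F\<close> is an antiderivative of \<open>?f\<close>, and
  \<open>mpowr_bounds\<close> makes it vanish at both ends, so the integral of \<open>?f\<close> is
  0.\<close>

lemma mGamma_add_one: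
  fixes P :: "complex^'r^'r"
  assumes P: "positive_stable P"
  shows "mGamma (P + mat 1) = P ** mGamma P"
proof -
  have P1: "positive_stable (P + mat 1)" using positive_stable_add[OF P, of 1] by simp
  obtain d n C where b: "d > 0" "n > 0" "C \<ge> 0"
    "\<And>t. 0 < t \<Longrightarrow> t \<le> 1 \<Longrightarrow> norm (mpowr t P) \<le> C * t powr d"
    "\<And>t. t \<ge> 1 \<Longrightarrow> norm (mpowr t P) \<le> C * t ^ n"
    using mpowr_bounds[OF P] by metis
  let ?F = "\<lambda>t. exp (- t) *\<^sub>R mpowr t P"
  let ?g = "\<lambda>t. exp (- t) *\<^sub>R mpowr t (P - mat 1)"
  let ?f = "\<lambda>t. P ** ?g t - ?F t"
  have int_g: "set_integrable lborel {0<..} ?g" by (rule set_integrable_mGamma[OF P])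
  have int_F: "set_integrable lborel {0<..} ?F" using set_integrable_mGamma[OF P1] by simp
  note int_Pg = set_integral_bounded_linear[OF matrix_mult.bounded_linear_right int_g, of P]
  have zero_ereal: "(0::ereal) = ereal 0" by (simp add: zero_ereal_def)
  have "(LBINT t=0..\<infinity>. ?f t) = 0 - 0"
  proof (rule interval_integral_FTC_integrable)
    fix t :: real assume "0 < ereal t"
    hence t: "t > 0" by simp
    have "((\<lambda>t. exp (- t)) has_real_derivative - exp (- t)) (at t)"
      by (auto intro!: derivative_eq_intros)
    from has_vector_derivative_scaleR[OF this mpowr_has_vector_derivative[OF t, of P]]
    show "(?F has_vector_derivative ?f t) (at t)"
      by (simp add: matrix_mult.scaleR_right)
    show "isCont ?f t"
      using t by (intro continuous_diff bounded_linear.isCont[OF matrix_mult.bounded_linear_right] isCont_Gamma_integrand) auto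
  next
    have "einterval 0 \<infinity> = {0<..}" by (auto simp: einterval_def)
    thus "set_integrable lborel (einterval 0 \<infinity>) ?f"
      using int_Pg(2) int_F by simp
  next
    have "(?F \<longlongrightarrow> 0) (at_right 0)"
    proof (rule Lim_null_comparison)
      show "((\<lambda>t. C * t powr d) \<longlongrightarrow> 0) (at_right 0)"
        using b(1) by (auto intro!: tendsto_eq_intros simp: eventually_at_filter)
      have "eventually (\<lambda>t::real. t \<in> {0<..<1}) (at_right 0)"
        by (rule eventually_at_right_real) simp
      thus "eventually (\<lambda>t. norm (?F t) \<le> C * t powr d) (at_right 0)"
      proof eventually_elim
        case (elim t)
        have "norm (?F t) \<le> 1 * norm (mpowr t P)"
          unfolding norm_scaleR using elim by (intro mult_right_mono) auto
        also have "\<dots> \<le> C * t powr d" using b(4)[of t] elim by auto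
        finally show ?case .
      qed
    qed
    thus "((?F \<circ> real_of_ereal) \<longlongrightarrow> 0) (at_right 0)"
      unfolding zero_ereal ereal_tendsto_simps .
  next
    have "(?F \<longlongrightarrow> 0) at_top"
    proof (rule Lim_null_comparison)
      show "((\<lambda>t. C * (t ^ n / exp t)) \<longlongrightarrow> 0) at_top"
        using tendsto_mult_right_zero[OF tendsto_power_div_exp_0] .
      show "eventually (\<lambda>t. norm (?F t) \<le> C * (t ^ n / exp t)) at_top"
        using eventually_ge_at_top[of 1]
      proof eventually_elim
        case (elim t)
        thus ?case using b(5)[of t] by (simp add: exp_minus field_simps)
      qed
    qed
    thus "((?F \<circ> real_of_ereal) \<longlongrightarrow> 0) (at_left \<infinity>)"
      unfolding ereal_tendsto_simps .
  qed simp
  hence "(LINT t:{0<..}|lborel. ?f t) = 0"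
    by (simp add: interval_lebesgue_integral_0_infty)
  hence "(LINT t:{0<..}|lborel. P ** ?g t) = (LINT t:{0<..}|lborel. ?F t)"
    using set_integral_diff(2)[OF int_Pg(2) int_F] by simp
  thus ?thesis using int_Pg(1) by (simp add: mGamma_def)
qed

lemma mGamma_add_nat:
  fixes P :: "complex^'r^'r"
  assumes P: "positive_stable P"
  shows "mGamma (P + mat (of_nat n)) = mpoch P n ** mGamma P"
proof (induction n)
  case (Suc n)
  have c: "(P + mat (of_nat n)) ** mpoch P n = mpoch P n ** (P + mat (of_nat n))"
    by (rule mpoch_commute) (simp add: matrix_mult.add_left matrix_mult.add_right mat_mult_commute[of P])
  have "mGamma (P + mat (of_nat (Suc n))) = mGamma ((P + mat (of_nat n)) + mat 1)"
    by (simp add: mat_add add_ac)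
  also have "\<dots> = (P + mat (of_nat n)) ** (mpoch P n ** mGamma P)"
    using mGamma_add_one[OF positive_stable_add_nat[OF P]] Suc by simp
  finally show ?case by (simp add: matrix_mul_assoc c)
qed simp

text \<open>On an eigenvector the matrix power acts as the scalar power with exponent
  \<open>c - 1\<close>, so the integral reduces to Euler's integral for the complex Gamma
  function.\<close>

lemma mGamma_eigenvector:
  fixes P :: "complex^'r^'r"
  assumes P: "positive_stable P" and v: "v \<noteq> 0" "P *v v = c *s v"
  shows "mGamma P *v v = Gamma c *s v"
proof -
  have c: "Re c > 0" using P v by (auto simp: positive_stable_def)
  have eq: "(exp (- t) *\<^sub>R mpowr t (P - mat 1)) *v v = (of_real t powr (c - 1) / of_real (exp t)) *s v"
    if t: "t > 0" for t
  proof -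
    have "(ln t *\<^sub>R (P - mat 1)) *v v = (of_real (ln t) * (c - 1)) *s v"
      by (simp add: matrix_vector.scaleR_left matrix_vector.diff_left v vec_eq_iff
          scaleR_conv_of_real[where 'a = complex] algebra_simps)
    hence "mpowr t (P - mat 1) *v v = exp (of_real (ln t) * (c - 1)) *s v"
      unfolding mpowr_def by (rule mexp_eigenvector)
    also have "exp (of_real (ln t) * (c - 1)) = of_real t powr (c - 1)"
      using t by (simp add: powr_def Ln_of_real mult.commute)
    finally show ?thesis
      by (simp add: matrix_vector.scaleR_left vec_eq_iff scaleR_conv_of_real[where 'a = complex]
          exp_minus exp_of_real field_simps)
  qed
  note int = set_integral_bounded_linear[OF matrix_vector.bounded_linear_left set_integrable_mGamma[OF P], of v]
  have "mGamma P *v v = integral {0<..} (\<lambda>t. (exp (- t) *\<^sub>R mpowr t (P - mat 1)) *v v)"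
    unfolding mGamma_def int(1)[symmetric] by (rule set_borel_integral_eq_integral(2)[OF int(2)])
  also have "\<dots> = integral {0<..} (\<lambda>t. (of_real t powr (c - 1) / of_real (exp t)) *s v)"
    by (rule integral_cong) (auto simp: eq)
  also have "\<dots> = Gamma c *s v"
    using has_integral_linear[OF Gamma_integral_complex'[OF c] bounded_linear_vector_scale[of v]] by (simp add: o_def integral_unique)
  finally show ?thesis .
qed

lemma mGamma_invertible:
  fixes P :: "complex^'r^'r"
  assumes P: "positive_stable P"
  shows "invertible (mGamma P)"
proof (rule ccontr)
  assume "\<not> invertible (mGamma P)"
  then obtain v where "mGamma P *v v = 0" "v \<noteq> 0" by (auto simp: invertible_iff_ker)
  from ex_eigenvector_in_kernel[OF mGamma_commute[OF P refl] this]
  obtain c w where w: "w \<noteq> 0" "mGamma P *v w = 0" "P *v w = c *s w" by blast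
  have "Re c > 0" using P w by (auto simp: positive_stable_def)
  \<comment> \<open>The total function \<open>Gamma\<close> takes the value 0 at its poles, the
    nonpositive integers, and nowhere else.\<close>
  hence "Gamma c \<noteq> 0" by (auto simp: Gamma_eq_zero_iff elim!: nonpos_Ints_cases)
  thus False using mGamma_eigenvector[OF P w(1,3)] w by (simp add: vec_eq_iff)
qed

section \<open>The shifted beta matrix function\<close>

text \<open>Shifting \<open>B\<close> and \<open>C\<close> together leaves \<open>C - B\<close>
  fixed, so the functional equation turns the beta matrix \<open>X\<close> into
  \<open>b ** X ** matrix_inv c\<close>. After inversion \<open>b\<close> cancels directly;
  \<open>c\<close> must first be moved past the inverse of \<open>X\<close>, which uses that
  \<open>B\<close> and \<open>C\<close> commute.\<close>

lemma mBeta_shift: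
  fixes B C :: "complex^'r^'r"
  assumes B: "positive_stable B" and C: "positive_stable C" and CB: "positive_stable (C - B)"
    and comm: "B ** C = C ** B"
  shows "matrix_inv (mBeta (B + mat (of_nat n)) (C - B)) ** mpoch B n ** matrix_inv (mpoch C n)
    = matrix_inv (mBeta B (C - B))"
proof -
  define Q where "Q = C - B"
  define X where "X = mBeta B Q"
  define b where "b = mpoch B n"
  define c where "c = mpoch C n"
  define GB where "GB = mGamma B"
  define GQ where "GQ = mGamma Q"
  define GC where "GC = mGamma C"
  have Q: "positive_stable Q" using CB by (simp add: Q_def)
  have inv: "invertible b" "invertible c" "invertible GB" "invertible GQ" "invertible GC"
    using B C Q by (simp_all add: b_def c_def GB_def GQ_def GC_def mGamma_invertible
        positive_stable_mpoch_invertible)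
  have X: "X = GB ** GQ ** matrix_inv GC"
    by (simp add: X_def mBeta_def GB_def GQ_def GC_def Q_def)
  have cB: "c ** B = B ** c" unfolding c_def by (rule mpoch_commute[symmetric, OF comm])
  have cC: "c ** C = C ** c" unfolding c_def by (rule mpoch_commute[symmetric, OF refl])
  have cQ: "c ** Q = Q ** c"
    by (simp add: Q_def matrix_mult.diff_left matrix_mult.diff_right cB cC)
  have "c ** GB = GB ** c" "c ** GQ = GQ ** c" "c ** GC = GC ** c"
    unfolding GB_def GQ_def GC_def by (simp_all add: mGamma_commute B C Q cB cC cQ)
  hence c_inv: "matrix_inv GC ** c = c ** matrix_inv GC"
    using matrix_inv_commute[OF inv(5)] by simp
  have cX: "c ** X = X ** c"
    unfolding X using \<open>c ** GB = GB ** c\<close> \<open>c ** GQ = GQ ** c\<close> c_inv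
    by (intro mult_commute_trans) auto
  have invX: "invertible X"
    unfolding X by (intro invertible_mult invertible_matrix_inv inv)
  have "mBeta (B + mat (of_nat n)) Q = b ** GB ** GQ ** matrix_inv (c ** GC)"
    using mGamma_add_nat[OF B, of n] mGamma_add_nat[OF C, of n]
    by (simp add: mBeta_def Q_def b_def c_def GB_def GQ_def GC_def algebra_simps)
  also have "\<dots> = b ** X ** matrix_inv c"
    by (simp add: X matrix_inv_mult inv matrix_mul_assoc)
  finally have "matrix_inv (mBeta (B + mat (of_nat n)) Q) = matrix_inv (b ** X ** matrix_inv c)"
    by simp
  also have "\<dots> = c ** matrix_inv X ** matrix_inv b"
    using inv invX matrix_inv_eqI[OF matrix_inv_left[OF inv(2)]]
    by (simp add: matrix_inv_mult invertible_mult invertible_matrix_inv matrix_mul_assoc)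
  finally have "matrix_inv (mBeta (B + mat (of_nat n)) Q) ** b ** matrix_inv c
      = c ** matrix_inv X ** (matrix_inv b ** b) ** matrix_inv c"
    by (simp add: matrix_mul_assoc)
  also have "\<dots> = matrix_inv X ** (c ** matrix_inv c)"
    using matrix_inv_commute[OF invX cX[symmetric]] by (simp add: matrix_inv_left inv matrix_mul_assoc)
  also have "\<dots> = matrix_inv X" by (simp add: matrix_inv_right inv)
  finally show ?thesis by (simp add: b_def c_def X_def Q_def)
qed

section \<open>Convergence and termwise differentiation\<close>

text \<open>Right multiplication by the factor with index \<open>n\<close> increases the norm at
  most by \<open>a + n\<close>, the corresponding factor of a real Pochhammer symbol.\<close>

lemma norm_mpoch_le:
  "\<exists>a>0. \<forall>n. norm (mpoch (M :: complex^'r^'r) n) \<le> norm (mat 1 :: complex^'r^'r) * pochhammer a n"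
proof -
  obtain K where K: "K > 0" "\<And>(a :: complex^'r^'r) (b :: complex^'r^'r). norm (a ** b) \<le> norm a * norm b * K"
    using matrix_mult.pos_bounded[where 'r = 'r] by blast
  define a where "a = norm M * K + 1"
  have a: "a > 0" "norm M * K \<le> a" using K by (auto simp: a_def intro: add_nonneg_pos)
  have "norm (mpoch M n) \<le> norm (mat 1 :: complex^'r^'r) * pochhammer a n" for n
  proof (induction n)
    case (Suc n)
    have "mpoch M (Suc n) = mpoch M n ** M + real n *\<^sub>R mpoch M n"
      using mat_of_real_mult[of "real n" "mpoch M n"]
      by (simp add: matrix_mult.add_right mat_mult_commute[of "mpoch M n"])
    hence "norm (mpoch M (Suc n)) \<le> norm (mpoch M n ** M) + norm (real n *\<^sub>R mpoch M n)"
      by (metis norm_triangle_ineq)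
    also have "\<dots> \<le> norm (mpoch M n) * (norm M * K) + norm (mpoch M n) * real n"
      using K(2)[of "mpoch M n" M] by (simp add: mult_ac)
    also have "\<dots> = norm (mpoch M n) * (norm M * K + real n)" by (simp add: distrib_left)
    also have "\<dots> \<le> norm (mat 1 :: complex^'r^'r) * pochhammer a n * (a + real n)"
      using Suc a K order_trans[OF norm_ge_zero Suc] by (intro mult_mono) auto
    finally show ?case by (simp add: pochhammer_Suc mult_ac)
  qed simp
  thus ?thesis using a(1) by blast
qed

text \<open>This is the binomial series of \<open>(1 - x) powr (- a)\<close>; the signs in the
  coefficients cancel those of the powers of \<open>- x\<close>.\<close>

lemma summable_pochhammer_div_fact:
  fixes a x :: real
  assumes "\<bar>x\<bar> < 1"
  shows "summable (\<lambda>n. pochhammer a n / fact n * x ^ n)"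
proof -
  have "(\<lambda>n. ((- a) gchoose n) * (- x) ^ n) sums (1 + - x) powr (- a)"
    by (rule gen_binomial_real) (use assms in simp)
  moreover have "((- a) gchoose n) * (- x) ^ n = pochhammer a n / fact n * x ^ n" for n
  proof -
    have "((- a) gchoose n) * (- x) ^ n = ((- 1) ^ n * (- 1) ^ n) * (pochhammer a n / fact n * x ^ n)"
      unfolding gbinomial_pochhammer power_minus[of x n] by simp
    thus ?thesis by simp
  qed
  ultimately show ?thesis by (simp add: sums_iff)
qed

text \<open>
  The integrands for consecutive \<open>n\<close> differ by the factor \<open>t \<le> 1\<close>. Hence either one of them is
  integrable and dominates all later ones, or none is and all the integrals are 0 by convention.
\<close>
lemma Bseq_ext_mBeta: "Bseq (\<lambda>n. ext_mBeta A B Y (P + mat (of_nat n)) Q)"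
proof -
  define h where "h P t = indicator {0<..<1} t *\<^sub>R (hyp1F1 A B (- ((1 / (t * (1 - t))) *\<^sub>R Y))
      ** mpowr t (P - mat 1) ** mpowr (1 - t) (Q - mat 1))" for P t
  have E: "ext_mBeta A B Y P Q = integral\<^sup>L lborel (h P)" for P
    by (simp add: ext_mBeta_def h_def[abs_def] set_lebesgue_integral_def)
  have step: "h (P + mat (of_nat n)) t = t ^ n *\<^sub>R h P t" for P n t
  proof (cases "t \<in> {0<..<1}")
    case True
    have "P + mat (of_nat n) - mat 1 = P - mat 1 + mat (of_nat n)" by simp
    hence "mpowr t (P + mat (of_nat n) - mat 1) = t ^ n *\<^sub>R mpowr t (P - mat 1)"
      using True by (simp only: mpowr_add_nat greaterThanLessThan_iff)
    thus ?thesis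
      using True by (simp add: h_def matrix_mult.scaleR_left matrix_mult.scaleR_right)
  qed (simp add: h_def)
  show ?thesis
  proof (cases "\<exists>k. integrable lborel (h (P + mat (of_nat k)))")
    case True
    then obtain k where k: "integrable lborel (h (P + mat (of_nat k)))" by blast
    have "norm (ext_mBeta A B Y (P + mat (of_nat (n + k))) Q)
        \<le> (LINT t|lborel. norm (h (P + mat (of_nat k)) t))" for n
    proof -
      have "P + mat (of_nat (n + k)) = P + mat (of_nat k) + mat (of_nat n)"
        by (simp add: mat_add add_ac)
      hence "norm (ext_mBeta A B Y (P + mat (of_nat (n + k))) Q)
          \<le> (LINT t|lborel. norm (t ^ n *\<^sub>R h (P + mat (of_nat k)) t))"
        unfolding E by (simp only: step[abs_def] integral_norm_bound)
      also have "\<dots> \<le> (LINT t|lborel. norm (h (P + mat (of_nat k)) t))"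
      proof (rule integral_mono')
        show "integrable lborel (\<lambda>t. norm (h (P + mat (of_nat k)) t))"
          using k by simp
        show "norm (t ^ n *\<^sub>R h (P + mat (of_nat k)) t) \<le> norm (h (P + mat (of_nat k)) t)" for t
        proof (cases "t \<in> {0<..<1}")
          case True
          thus ?thesis by (auto intro!: mult_left_le_one_le power_le_one)
        qed (simp add: h_def)
      qed simp
      finally show ?thesis .
    qed
    \<comment> \<open>Only the terms from index \<open>k\<close> on are bounded explicitly; the
      finitely many earlier ones do not affect boundedness.\<close>
    hence "Bseq (\<lambda>n. ext_mBeta A B Y (P + mat (of_nat (n + k))) Q)" by (rule BseqI')
    thus ?thesis by (rule Bseq_offset)
  next
    case False
    hence "ext_mBeta A B Y (P + mat (of_nat n)) Q = 0" for n
      by (simp add: E not_integrable_integral_eq)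
    thus ?thesis by (simp add: Bseq_def exI[of _ 1])
  qed
qed

text \<open>The extended beta factors are bounded and the Pochhammer factor grows at most like a
  real Pochhammer symbol, so a binomial series in \<open>norm z\<close> dominates.\<close>

lemma ext_hyp2F1_sums:
  fixes A1 :: "complex^'r^'r"
  assumes "norm z < 1"
  shows "(\<lambda>n. mscale (z ^ n / fact n)
        (mpoch A1 n ** ext_mBeta A B Y (B1 + mat (of_nat n)) (C1 - B1)
          ** matrix_inv (mBeta B1 (C1 - B1)))) sums ext_hyp2F1 A B Y A1 B1 C1 z"
proof -
  define E where "E n = ext_mBeta A B Y (B1 + mat (of_nat n)) (C1 - B1)" for n
  define X where "X = matrix_inv (mBeta B1 (C1 - B1))"
  obtain K where K: "K > 0" "\<And>(a :: complex^'r^'r) (b :: complex^'r^'r). norm (a ** b) \<le> norm a * norm b * K"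
    using matrix_mult.pos_bounded[where 'r = 'r] by blast
  obtain L where L: "L > 0" "\<And>n. norm (E n) \<le> L"
    using Bseq_ext_mBeta[of A B Y B1 "C1 - B1"] unfolding Bseq_def E_def by blast
  obtain a where a: "a > 0" "\<And>n. norm (mpoch A1 n) \<le> norm (mat 1 :: complex^'r^'r) * pochhammer a n"
    using norm_mpoch_le by blast
  define N where "N = norm (mat 1 :: complex^'r^'r)"
  have "summable (\<lambda>n. (N * L * K * norm X * K) * (pochhammer a n / fact n * norm z ^ n))"
    by (intro summable_mult summable_pochhammer_div_fact) (use assms in simp)
  hence "summable (\<lambda>n. mscale (z ^ n / fact n) (mpoch A1 n ** E n ** X))"
  proof (rule summable_comparison_test')
    fix n
    have "norm (mpoch A1 n ** E n) \<le> norm (mpoch A1 n) * norm (E n) * K" by (rule K)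
    also have "\<dots> \<le> (N * pochhammer a n) * L * K"
      using a(2)[of n] L K order_trans[OF norm_ge_zero a(2)[of n]]
      by (intro mult_mono) (auto simp: N_def)
    finally have 1: "norm (mpoch A1 n ** E n) \<le> (N * pochhammer a n) * L * K" .
    have "norm (mpoch A1 n ** E n ** X) \<le> norm (mpoch A1 n ** E n) * norm X * K" by (rule K)
    also have "\<dots> \<le> (N * pochhammer a n) * L * K * norm X * K"
      using K by (intro mult_right_mono 1) auto
    finally have "norm (z ^ n / fact n) * norm (mpoch A1 n ** E n ** X)
       \<le> norm (z ^ n / fact n) * ((N * pochhammer a n) * L * K * norm X * K)"
      by (rule mult_left_mono) simp
    also have "\<dots> = (N * L * K * norm X * K) * (pochhammer a n / fact n * norm z ^ n)"
      by (simp add: norm_divide norm_power)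
    finally show "norm (mscale (z ^ n / fact n) (mpoch A1 n ** E n ** X))
       \<le> (N * L * K * norm X * K) * (pochhammer a n / fact n * norm z ^ n)"
      by (simp add: norm_mscale)
  qed
  thus ?thesis unfolding ext_hyp2F1_def E_def X_def by (rule summable_sums)
qed

section \<open>Scalar power series and their iterated derivatives\<close>

lemma power_series_has_field_derivative:
  fixes c :: "nat \<Rightarrow> complex"
  assumes f: "\<And>z. norm z < 1 \<Longrightarrow> (\<lambda>n. c n / fact n * z ^ n) sums f z" and z: "norm z < 1"
  shows "(f has_field_derivative deriv f z) (at z)"
    and "(\<lambda>n. c (Suc n) / fact n * z ^ n) sums deriv f z"
proof -
  let ?g = "\<lambda>z. \<Sum>n. c n / fact n * z ^ n"
  \<comment> \<open>Dividing the coefficients by factorials makes differentiation a pure index shift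
    of \<open>c\<close>.\<close>
  have diffs: "diffs (\<lambda>n. c n / fact n) = (\<lambda>n. c (Suc n) / fact n)"
    by (simp add: diffs_def fun_eq_iff field_simps del: of_nat_Suc)
  have sm: "summable (\<lambda>n. c n / fact n * z ^ n)" if "norm z < 1" for z
    using f[OF that] by (rule sums_summable)
  have "(?g has_field_derivative (\<Sum>n. c (Suc n) / fact n * z ^ n)) (at z)"
    using termdiffs_strong'[OF sm z] unfolding diffs .
  hence *: "(f has_field_derivative (\<Sum>n. c (Suc n) / fact n * z ^ n)) (at z)"
    by (rule has_field_derivative_transform_within_open[of _ _ _ "ball 0 1"])
      (use z sums_unique[OF f] in auto)
  hence d: "deriv f z = (\<Sum>n. c (Suc n) / fact n * z ^ n)" by (rule DERIV_imp_deriv)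
  with * show "(f has_field_derivative deriv f z) (at z)" by simp
  have "summable (\<lambda>n. diffs (\<lambda>n. c n / fact n) n * z ^ n)"
    using termdiff_converges[OF z sm] .
  thus "(\<lambda>n. c (Suc n) / fact n * z ^ n) sums deriv f z"
    unfolding d diffs by (rule summable_sums)
qed

lemma power_series_higher_deriv:
  fixes c :: "nat \<Rightarrow> complex"
  assumes "\<And>z. norm z < 1 \<Longrightarrow> (\<lambda>n. c n / fact n * z ^ n) sums f z" and "norm z < 1"
  shows "(\<lambda>n. c (n + k) / fact n * z ^ n) sums (deriv ^^ k) f z"
  using assms(1)
proof (induction k arbitrary: f c)
  case 0
  thus ?case using assms(2) by simp
next
  case (Suc k)
  \<comment> \<open>The innermost derivative is taken first, so the induction hypothesis is needed
    for the function \<open>deriv f\<close> and the shifted coefficients.\<close>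
  from Suc.IH[of "\<lambda>n. c (Suc n)" "deriv f"] power_series_has_field_derivative(2)[OF Suc.prems]
  show ?case by (simp add: funpow_Suc_right del: funpow.simps)
qed

text \<open>The derivative is read entrywise. As \<open>deriv\<close> is a total operator,
  holomorphy of the entries is asserted too, which makes the iterated \<open>deriv\<close> a genuine
  derivative on the unit disc.\<close>

theorem theorem4p3:
  fixes A B Y A1 B1 C1 :: "complex^'r^'r"
  assumes "positive_stable A" "positive_stable B" "positive_stable Y"
    and "positive_stable A1" "positive_stable B1" "positive_stable C1"
    and "positive_stable (C1 - B1)"
    and "B1 ** C1 = C1 ** B1"
  shows "\<forall>i j. (\<lambda>w. ext_hyp2F1 A B Y A1 B1 C1 w $ i $ j) holomorphic_on ball 0 1 \<and>
    (\<forall>n z. norm z < 1 \<longrightarrow>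
      (deriv ^^ n) (\<lambda>w. ext_hyp2F1 A B Y A1 B1 C1 w $ i $ j) z =
      (mpoch A1 n
        ** ext_hyp2F1 A B Y (A1 + mat (of_nat n)) (B1 + mat (of_nat n)) (C1 + mat (of_nat n)) z
        ** mpoch B1 n ** matrix_inv (mpoch C1 n)) $ i $ j)"
proof (intro allI conjI impI)
  fix i j :: 'r
  define D where "D n = mpoch A1 n ** ext_mBeta A B Y (B1 + mat (of_nat n)) (C1 - B1)
          ** matrix_inv (mBeta B1 (C1 - B1))" for n
  define f where "f w = ext_hyp2F1 A B Y A1 B1 C1 w $ i $ j" for w
  have f_sums: "(\<lambda>m. D m $ i $ j / fact m * z ^ m) sums f z" if "norm z < 1" for z
    using bounded_linear.sums[OF bounded_linear_vec_nth2 ext_hyp2F1_sums[OF that], of A1 A B Y B1 C1 i j]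
    by (simp add: D_def f_def mscale_def mult.commute)
  show "(\<lambda>w. ext_hyp2F1 A B Y A1 B1 C1 w $ i $ j) holomorphic_on ball 0 1"
    unfolding f_def[symmetric] holomorphic_on_open[OF open_ball]
    by (intro ballI exI) (rule power_series_has_field_derivative(1)[OF f_sums], auto)
  fix n :: nat and z :: complex assume z: "norm z < 1"
  let ?N = "mat (of_nat n) :: complex^'r^'r"
  let ?L = "mpoch A1 n" and ?R = "mpoch B1 n ** matrix_inv (mpoch C1 n)"
  let ?T = "\<lambda>X. (?L ** X ** ?R) $ i $ j"
  \<comment> \<open>The coefficients of the shifted series: the common shift cancels in the
    difference, which is why \<open>C1 - B1\<close> appears unshifted.\<close>
  define D' where "D' m = mpoch (A1 + ?N) m ** ext_mBeta A B Y (B1 + ?N + mat (of_nat m)) (C1 - B1)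
          ** matrix_inv (mBeta (B1 + ?N) (C1 - B1))" for m
  have D: "D (m + n) = ?L ** D' m ** ?R" for m
  proof -
    have "D (m + n) = ?L ** (mpoch (A1 + ?N) m ** ext_mBeta A B Y (B1 + ?N + mat (of_nat m)) (C1 - B1))
        ** matrix_inv (mBeta B1 (C1 - B1))"
      by (simp add: D_def add.commute[of m n] mpoch_add mat_add add.assoc matrix_mul_assoc)
    also have "\<dots> = ?L ** (mpoch (A1 + ?N) m ** ext_mBeta A B Y (B1 + ?N + mat (of_nat m)) (C1 - B1))
        ** (matrix_inv (mBeta (B1 + ?N) (C1 - B1)) ** mpoch B1 n ** matrix_inv (mpoch C1 n))"
      \<comment> \<open>Read from right to left, the beta shift makes the right-hand factors
        \<open>mpoch B1 n\<close> and \<open>matrix_inv (mpoch C1 n)\<close> appear.\<close>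
      by (simp only: mBeta_shift[OF assms(5-8)])
    finally show ?thesis by (simp only: D'_def matrix_mul_assoc)
  qed
  \<comment> \<open>Multiplying by the outer factors and taking an entry is continuous and linear,
    so it passes through the series.\<close>
  have "bounded_linear ?T"
    by (rule bounded_linear_compose[OF bounded_linear_vec_nth2
          bounded_linear_compose[OF matrix_mult.bounded_linear_left matrix_mult.bounded_linear_right]])
  from bounded_linear.sums[OF this ext_hyp2F1_sums[OF z, of "A1 + ?N" A B Y "B1 + ?N" "C1 + ?N"]]
  have "(\<lambda>m. ?T (mscale (z ^ m / fact m) (D' m)))
      sums ?T (ext_hyp2F1 A B Y (A1 + ?N) (B1 + ?N) (C1 + ?N) z)"
    unfolding D'_def by simp
  moreover have "?T (mscale (z ^ m / fact m) (D' m)) = D (m + n) $ i $ j / fact m * z ^ m" for m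
  proof -
    have "?L ** mscale x X ** ?R = mscale x (?L ** X ** ?R)" for x X
      by (simp add: mat_mult_eq_mscale[symmetric] matrix_mul_assoc mat_mult_commute[of ?L])
    thus ?thesis by (simp add: D mscale_nth)
  qed
  ultimately have "(\<lambda>m. D (m + n) $ i $ j / fact m * z ^ m)
      sums ?T (ext_hyp2F1 A B Y (A1 + ?N) (B1 + ?N) (C1 + ?N) z)" by simp
  from sums_unique2[OF power_series_higher_deriv[OF f_sums z] this]
  show "(deriv ^^ n) (\<lambda>w. ext_hyp2F1 A B Y A1 B1 C1 w $ i $ j) z =
      (mpoch A1 n ** ext_hyp2F1 A B Y (A1 + ?N) (B1 + ?N) (C1 + ?N) z
        ** mpoch B1 n ** matrix_inv (mpoch C1 n)) $ i $ j"
    unfolding f_def by (simp add: matrix_mul_assoc)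
qed

end
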